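(* Let $M$ be a monoid with $$M\cong\prod_{\lambda\in\Lambda}P_\lambda^{I_\lambda},$$ where $\Lambda$ is an index set, the $P_\lambda$ ($\lambda\in\Lambda$) are pairwise nonisomorphic nontrivial monoids with zero satisfying $\mathrm{CCE}(P_\lambda)=\{0,1\}$, and each $I_\lambda$ is a nonempty set (all index sets possibly infinite). Then $$\mathrm{Aut}(M)\cong\prod_{\lambda\in\Lambda}\left(\mathrm{Aut}(P_\lambda)^{I_\lambda}\rtimes\mathrm{Sym}(I_\lambda)\right)$$ as groups, where $\mathrm{Sym}(I_\lambda)$ acts on $\mathrm{Aut}(P_\lambda)^{I_\lambda}$ by permuting the coordinates.
   Context: A monoid with zero is a monoid with an absorbing element $0$ ($0x=x0=0$ for all $x$); it is nontrivial if it has more than one element (equivalently $0\neq 1$). For a monoid $M$, $\mathrm{CE}(M)=\{e\in M: e^2=e,\ ex=xe\ \text{for all }x\in M\}$ is the set of central idempotents, partially ordered by $e\le f\iff ef=e$. If $M$ has a zero, $e\in\mathrm{CE}(M)$ is complemented if there is $f\in\mathrm{CE}(M)$ such that $ef=0$ and $1$ is the unique common upper bound of $e$ and $f$ in $\mathrm{CE}(M)$; $\mathrm{CCE}(M)$ denotes the set of complemented central idempotents. $\mathrm{Aut}$ denotes the group of monoid automorphisms, $P^{I}$ the direct power (coordinatewise multiplication), and $\mathrm{Sym}(I)$ the group of all bijections $I\to I$. *)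

theory Defs
  imports "HOL-Algebra.Algebra"
begin

locale monoid_with_zero = monoid M for M (structure) +
  assumes zero_exists: "\<exists>z\<in>carrier M. \<forall>x\<in>carrier M. z \<otimes> x = z \<and> x \<otimes> z = z"

definition monoid_zero :: "('a, 'b) monoid_scheme \<Rightarrow> 'a"
  where "monoid_zero M =
    (THE z. z \<in> carrier M \<and> (\<forall>x\<in>carrier M. z \<otimes>\<^bsub>M\<^esub> x = z \<and> x \<otimes>\<^bsub>M\<^esub> z = z))"

lemma (in monoid_with_zero) monoid_zero:
  "monoid_zero M \<in> carrier M \<and>
   (\<forall>x\<in>carrier M. monoid_zero M \<otimes> x = monoid_zero M \<and> x \<otimes> monoid_zero M = monoid_zero M)"
  unfolding monoid_zero_def
proof (rule theI')
  show "\<exists>!z. z \<in> carrier M \<and> (\<forall>x\<in>carrier M. z \<otimes> x = z \<and> x \<otimes> z = z)"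
    using zero_exists by (metis (no_types, lifting))
qed

definition CE :: "('a, 'b) monoid_scheme \<Rightarrow> 'a set"
  where "CE M = {e \<in> carrier M. e \<otimes>\<^bsub>M\<^esub> e = e \<and> (\<forall>x\<in>carrier M. e \<otimes>\<^bsub>M\<^esub> x = x \<otimes>\<^bsub>M\<^esub> e)}"

definition CE_le :: "('a, 'b) monoid_scheme \<Rightarrow> 'a \<Rightarrow> 'a \<Rightarrow> bool"
  where "CE_le M e f \<longleftrightarrow> e \<otimes>\<^bsub>M\<^esub> f = e"

text \<open>Only meaningful for a monoid with zero, since otherwise \<^term>\<open>monoid_zero M\<close> is unspecified.\<close>

definition CCE :: "('a, 'b) monoid_scheme \<Rightarrow> 'a set"
  where "CCE M = {e \<in> CE M. \<exists>f\<in>CE M. e \<otimes>\<^bsub>M\<^esub> f = monoid_zero M \<and>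
    (\<forall>u\<in>CE M. CE_le M e u \<and> CE_le M f u \<longleftrightarrow> u = \<one>\<^bsub>M\<^esub>)}"

text \<open>
  In the library, \<^const>\<open>hom\<close> (hence \<^const>\<open>iso\<close> and \<^const>\<open>auto\<close>) only asks for
  multiplicativity. For bijections between monoids preservation of the unit is automatic, so
  \<^term>\<open>M \<cong> N\<close> is isomorphism of monoids and \<^term>\<open>AutoGroup M\<close> is the group of
  monoid automorphisms.
\<close>

lemma iso_preserves_one:
  assumes "monoid M" "monoid N" "h \<in> iso M N"
  shows "h \<one>\<^bsub>M\<^esub> = \<one>\<^bsub>N\<^esub>"
proof -
  interpret M: monoid M by fact
  interpret N: monoid N by fact
  have mult: "h (x \<otimes>\<^bsub>M\<^esub> y) = h x \<otimes>\<^bsub>N\<^esub> h y" if "x \<in> carrier M" "y \<in> carrier M" for x y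
    using assms(3) that by (simp add: iso_def hom_def)
  have img: "h ` carrier M = carrier N"
    using assms(3) by (simp add: iso_def bij_betw_def)
  then obtain x where x: "x \<in> carrier M" "h x = \<one>\<^bsub>N\<^esub>"
    by (metis N.one_closed imageE)
  have "h \<one>\<^bsub>M\<^esub> \<in> carrier N"
    using img by blast
  then show ?thesis
    using mult[of x "\<one>\<^bsub>M\<^esub>"] x by simp
qed

lemma AutoGroup_eq:
  "AutoGroup M = BijGroup (carrier M) \<lparr>carrier := iso M M \<inter> extensional (carrier M)\<rparr>"
  by (auto simp: AutoGroup_def auto_def Bij_def iso_def intro!: arg_cong[where f = "\<lambda>c. _\<lparr>carrier := c\<rparr>"])

lemma group_AutoGroup_monoid:
  assumes "monoid M"
  shows "group (AutoGroup M)"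
proof -
  interpret monoid M by fact
  have "subgroup (auto M) (BijGroup (carrier M))"
  proof (rule subgroup.intro)
    show "auto M \<subseteq> carrier (BijGroup (carrier M))"
      by (force simp: auto_def BijGroup_def)
    show "x \<otimes>\<^bsub>BijGroup (carrier M)\<^esub> y \<in> auto M" if "x \<in> auto M" "y \<in> auto M" for x y
      using that
      by (auto simp: auto_def BijGroup_def compose_Bij) (auto simp: hom_def compose_def Pi_iff)
    show "\<one>\<^bsub>BijGroup (carrier M)\<^esub> \<in> auto M"
      by (auto simp: auto_def BijGroup_def id_Bij hom_def)
    show "inv\<^bsub>BijGroup (carrier M)\<^esub> x \<in> auto M" if "x \<in> auto M" for x
    proof -
      have x: "x \<in> Bij (carrier M)" "x \<in> hom M M"
        using that by (auto simp: auto_def)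
      have "inv_into (carrier M) x (a \<otimes>\<^bsub>M\<^esub> b) = inv_into (carrier M) x a \<otimes>\<^bsub>M\<^esub> inv_into (carrier M) x b"
        if "a \<in> carrier M" "b \<in> carrier M" for a b
        by (rule Bij_inv_into_lemma) (use x that in \<open>auto simp: hom_def\<close>)
      then have "restrict (inv_into (carrier M) x) (carrier M) \<in> hom M M"
        using x by (auto simp: hom_def Bij_inv_into_mem)
      then show ?thesis
        using x by (simp add: inv_BijGroup auto_def restrict_inv_into_Bij)
    qed
  qed
  then show ?thesis
    unfolding AutoGroup_def by (rule subgroup.subgroup_is_group[OF _ group_BijGroup])
qed

definition semidirect_product ::
    "('n, 'a) monoid_scheme \<Rightarrow> ('h, 'b) monoid_scheme \<Rightarrow> ('h \<Rightarrow> 'n \<Rightarrow> 'n) \<Rightarrow> ('n \<times> 'h) monoid"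
  where "semidirect_product N H \<phi> =
    \<lparr>carrier = carrier N \<times> carrier H,
     monoid.mult = (\<lambda>(n, h) (n', h'). (n \<otimes>\<^bsub>N\<^esub> \<phi> h n', h \<otimes>\<^bsub>H\<^esub> h')),
     one = (\<one>\<^bsub>N\<^esub>, \<one>\<^bsub>H\<^esub>)\<rparr>"

lemma group_semidirect_product:
  assumes "group N" "group H"
    and hom: "\<And>h. h \<in> carrier H \<Longrightarrow> \<phi> h \<in> hom N N"
    and act: "\<And>g h n. g \<in> carrier H \<Longrightarrow> h \<in> carrier H \<Longrightarrow> n \<in> carrier N \<Longrightarrow>
                \<phi> (g \<otimes>\<^bsub>H\<^esub> h) n = \<phi> g (\<phi> h n)"
    and act_one: "\<And>n. n \<in> carrier N \<Longrightarrow> \<phi> \<one>\<^bsub>H\<^esub> n = n"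
  shows "group (semidirect_product N H \<phi>)"
proof -
  interpret N: group N by fact
  interpret H: group H by fact
  have cl: "\<phi> h n \<in> carrier N" if "h \<in> carrier H" "n \<in> carrier N" for h n
    using hom[OF that(1)] that(2) by (auto simp: hom_def)
  have mult: "\<phi> h (n \<otimes>\<^bsub>N\<^esub> n') = \<phi> h n \<otimes>\<^bsub>N\<^esub> \<phi> h n'"
    if "h \<in> carrier H" "n \<in> carrier N" "n' \<in> carrier N" for h n n'
    using hom[OF that(1)] that(2,3) by (auto simp: hom_def)
  show ?thesis
  proof (rule groupI)
    fix x assume "x \<in> carrier (semidirect_product N H \<phi>)"
    then obtain n h where x: "x = (n, h)" "n \<in> carrier N" "h \<in> carrier H"
      by (auto simp: semidirect_product_def)
    let ?y = "(\<phi> (inv\<^bsub>H\<^esub> h) (inv\<^bsub>N\<^esub> n), inv\<^bsub>H\<^esub> h)"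
    have "\<phi> (inv\<^bsub>H\<^esub> h) (inv\<^bsub>N\<^esub> n) \<otimes>\<^bsub>N\<^esub> \<phi> (inv\<^bsub>H\<^esub> h) n = \<phi> (inv\<^bsub>H\<^esub> h) \<one>\<^bsub>N\<^esub>"
      using x mult[of "inv\<^bsub>H\<^esub> h" "inv\<^bsub>N\<^esub> n" n] by simp
    also have "\<dots> = \<one>\<^bsub>N\<^esub>"
      using x hom_one[OF hom \<open>group N\<close> \<open>group N\<close>] by simp
    finally show "\<exists>y\<in>carrier (semidirect_product N H \<phi>).
        y \<otimes>\<^bsub>semidirect_product N H \<phi>\<^esub> x = \<one>\<^bsub>semidirect_product N H \<phi>\<^esub>"
      using x cl by (intro bexI[of _ ?y]) (auto simp: semidirect_product_def)
  qed (auto simp: semidirect_product_def cl mult act act_one N.m_assoc H.m_assoc)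
qed

text \<open>
  The permutation \<open>\<sigma>\<close> moves the entry at position \<open>i\<close> to position \<open>\<sigma> i\<close>. The inverse makes this a left
  action, matching \<^const>\<open>BijGroup\<close>, whose product of \<open>\<sigma>\<close> and \<open>\<tau>\<close> is \<open>\<sigma>\<close> after \<open>\<tau>\<close>.
\<close>

definition permute_coords :: "'i set \<Rightarrow> ('i \<Rightarrow> 'i) \<Rightarrow> ('i \<Rightarrow> 'a) \<Rightarrow> 'i \<Rightarrow> 'a"
  where "permute_coords I \<sigma> f = (\<lambda>i\<in>I. f (inv_into I \<sigma> i))"

lemma group_semidirect_permute_coords:
  assumes "monoid P"
  shows "group (semidirect_product (product_group I (\<lambda>_. AutoGroup P)) (BijGroup I) (permute_coords I))"
proof (rule group_semidirect_product)
  show "group (product_group I (\<lambda>_. AutoGroup P))"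
    using assms by (simp add: group_AutoGroup_monoid)
  show "group (BijGroup I)"
    by (rule group_BijGroup)
  show "permute_coords I \<sigma> \<in> hom (product_group I (\<lambda>_. AutoGroup P)) (product_group I (\<lambda>_. AutoGroup P))"
    if "\<sigma> \<in> carrier (BijGroup I)" for \<sigma>
    using that
    by (auto simp: hom_def permute_coords_def BijGroup_def PiE_iff Bij_inv_into_mem)
  show "permute_coords I (\<sigma> \<otimes>\<^bsub>BijGroup I\<^esub> \<tau>) f = permute_coords I \<sigma> (permute_coords I \<tau> f)"
    if "\<sigma> \<in> carrier (BijGroup I)" "\<tau> \<in> carrier (BijGroup I)" for \<sigma> \<tau> and f :: "'c \<Rightarrow> 'a \<Rightarrow> 'a"
  proof -
    have st: "\<sigma> \<in> Bij I" "\<tau> \<in> Bij I" using that by (auto simp: BijGroup_def)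
    have "inv_into I (compose I \<sigma> \<tau>) i = inv_into I \<tau> (inv_into I \<sigma> i)" if i: "i \<in> I" for i
    proof (rule inv_into_f_eq)
      show "inj_on (compose I \<sigma> \<tau>) I"
        using compose_Bij[OF st] by (simp add: Bij_def bij_betw_def)
      show "inv_into I \<tau> (inv_into I \<sigma> i) \<in> I"
        using st i by (simp add: Bij_inv_into_mem)
      then show "compose I \<sigma> \<tau> (inv_into I \<tau> (inv_into I \<sigma> i)) = i"
        using st i bij_betw_inv_into_right[of \<tau> I I "inv_into I \<sigma> i"] bij_betw_inv_into_right[of \<sigma> I I i]
        by (simp add: compose_def Bij_def Bij_inv_into_mem)
    qed
    then show ?thesis
      using st by (auto simp: permute_coords_def BijGroup_def Bij_inv_into_mem fun_eq_iff restrict_def)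
  qed
  show "permute_coords I \<one>\<^bsub>BijGroup I\<^esub> f = f" if "f \<in> carrier (product_group I (\<lambda>_. AutoGroup P))" for f
  proof -
    have "inv_into I (\<lambda>i\<in>I. i) i = i" if "i \<in> I" for i
      using that by (intro inv_into_f_eq) (auto simp: inj_on_def)
    then show ?thesis
      using that by (auto simp: permute_coords_def BijGroup_def PiE_iff extensional_def fun_eq_iff)
  qed
qed

end

theory Submission
  imports Defs
begin

text \<open>
  Complemented central idempotents of a direct product are computed coordinatewise, so in
  \<open>R = \<Prod>\<^sub>j Q\<^sub>j\<close> with every \<open>CCE (Q\<^sub>j) = {0, 1}\<close> they form \<open>{0, 1}\<^sup>J\<close>, whose minimal nonzero elements are
  the elements \<open>\<delta>\<^sub>j\<close> with entry \<open>1\<close> at \<open>j\<close> and \<open>0\<close> elsewhere. An automorphism \<open>h\<close> therefore permutes the \<open>\<delta>\<^sub>j\<close>, say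
  \<open>h \<delta>\<^sub>j = \<delta>\<^bsub>\<pi> j\<^esub>\<close>. Since \<open>x \<delta>\<^sub>j\<close> records exactly the coordinate \<open>x\<^sub>j\<close>, the entry of \<open>h x\<close> at \<open>\<pi> j\<close> depends only on
  \<open>x\<^sub>j\<close>, through an isomorphism \<open>Q\<^sub>j \<cong> Q\<^bsub>\<pi> j\<^esub>\<close>. For \<open>J\<close> the disjoint union of the \<open>I\<^sub>\<lambda>\<close>, pairwise
  nonisomorphism of the \<open>P\<^sub>\<lambda>\<close> forces \<open>\<pi>\<close> to preserve each \<open>I\<^sub>\<lambda>\<close>.
\<close>

section \<open>Complemented central idempotents\<close>

lemma monoid_zero_eqI:
  assumes "z \<in> carrier M"
    and "\<And>x. x \<in> carrier M \<Longrightarrow> z \<otimes>\<^bsub>M\<^esub> x = z" "\<And>x. x \<in> carrier M \<Longrightarrow> x \<otimes>\<^bsub>M\<^esub> z = z"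
  shows "monoid_zero M = z"
  unfolding monoid_zero_def
proof (rule the_equality)
  show "z \<in> carrier M \<and> (\<forall>x\<in>carrier M. z \<otimes>\<^bsub>M\<^esub> x = z \<and> x \<otimes>\<^bsub>M\<^esub> z = z)"
    using assms by blast
  show "w = z" if "w \<in> carrier M \<and> (\<forall>x\<in>carrier M. w \<otimes>\<^bsub>M\<^esub> x = w \<and> x \<otimes>\<^bsub>M\<^esub> w = w)" for w
    using assms that by metis
qed

lemma (in monoid) one_in_CE: "\<one> \<in> CE G"
  by (simp add: CE_def)

lemma CE_closed: "e \<in> CE M \<Longrightarrow> e \<in> carrier M"
  by (simp add: CE_def)

lemma CCE_closed: "e \<in> CCE M \<Longrightarrow> e \<in> carrier M"
  by (simp add: CCE_def CE_def)

lemma (in monoid_with_zero) zero_closed: "monoid_zero M \<in> carrier M"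
  using monoid_zero by blast

lemma (in monoid_with_zero) zero_mult:
  "x \<in> carrier M \<Longrightarrow> monoid_zero M \<otimes> x = monoid_zero M"
  "x \<in> carrier M \<Longrightarrow> x \<otimes> monoid_zero M = monoid_zero M"
  using monoid_zero by blast+

lemma (in monoid_with_zero) zero_neq_one:
  assumes "\<exists>x\<in>carrier M. \<exists>y\<in>carrier M. x \<noteq> y"
  shows "monoid_zero M \<noteq> \<one>"
  using assms zero_mult by (metis r_one)

section \<open>Transport of zero, central idempotents and complements along isomorphisms\<close>

lemma iso_mult:
  "h \<in> iso M N \<Longrightarrow> x \<in> carrier M \<Longrightarrow> y \<in> carrier M \<Longrightarrow> h (x \<otimes>\<^bsub>M\<^esub> y) = h x \<otimes>\<^bsub>N\<^esub> h y"
  by (simp add: iso_def hom_def)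

lemma iso_closed: "h \<in> iso M N \<Longrightarrow> x \<in> carrier M \<Longrightarrow> h x \<in> carrier N"
  by (auto simp: iso_def hom_def)

lemma iso_inj: "h \<in> iso M N \<Longrightarrow> x \<in> carrier M \<Longrightarrow> y \<in> carrier M \<Longrightarrow> h x = h y \<longleftrightarrow> x = y"
  by (auto simp: iso_def bij_betw_def inj_on_def)

lemma iso_surj: "h \<in> iso M N \<Longrightarrow> y \<in> carrier N \<Longrightarrow> \<exists>x\<in>carrier M. h x = y"
  by (metis (mono_tags, lifting) bij_betw_def imageE iso_def mem_Collect_eq)

lemma iso_inv_into:
  assumes "monoid M" "h \<in> iso M N"
  shows "inv_into (carrier M) h \<in> iso N M"
    and "\<And>x. x \<in> carrier M \<Longrightarrow> inv_into (carrier M) h (h x) = x"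
    and "\<And>y. y \<in> carrier N \<Longrightarrow> h (inv_into (carrier M) h y) = y"
proof -
  interpret monoid M by fact
  have h: "bij_betw h (carrier M) (carrier N)" using assms(2) by (simp add: iso_def)
  let ?g = "inv_into (carrier M) h"
  show gh: "?g (h x) = x" if "x \<in> carrier M" for x
    using bij_betw_inv_into_left[OF h that] .
  show hg: "h (?g y) = y" if "y \<in> carrier N" for y
    using bij_betw_inv_into_right[OF h that] .
  have g: "bij_betw ?g (carrier N) (carrier M)" using bij_betw_inv_into[OF h] .
  have "?g (a \<otimes>\<^bsub>N\<^esub> b) = ?g a \<otimes>\<^bsub>M\<^esub> ?g b" if "a \<in> carrier N" "b \<in> carrier N" for a b
    using that bij_betwE[OF g] gh[of "?g a \<otimes>\<^bsub>M\<^esub> ?g b"] by (simp add: iso_mult[OF assms(2)] hg)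
  then show "?g \<in> iso N M"
    using g bij_betwE[OF g] by (intro isoI homI) blast+
qed

text \<open>Surjectivity makes the image of the zero absorb every element of \<open>N\<close>, and
  an absorbing element is unique.\<close>

lemma iso_zero:
  assumes "monoid_with_zero M" "h \<in> iso M N"
  shows "h (monoid_zero M) = monoid_zero N"
proof -
  interpret M: monoid_with_zero M by fact
  have "monoid_zero N = h (monoid_zero M)"
  proof (rule monoid_zero_eqI)
    fix y assume "y \<in> carrier N"
    then obtain x where "x \<in> carrier M" "y = h x"
      using iso_surj[OF assms(2)] by blast
    then show "h (monoid_zero M) \<otimes>\<^bsub>N\<^esub> y = h (monoid_zero M)"
      "y \<otimes>\<^bsub>N\<^esub> h (monoid_zero M) = h (monoid_zero M)"
      using M.zero_mult M.zero_closed by (simp_all flip: iso_mult[OF assms(2)])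
  qed (simp add: iso_closed[OF assms(2)] M.zero_closed)
  then show ?thesis ..
qed

lemma iso_CE_iff:
  assumes "monoid M" "h \<in> iso M N" "e \<in> carrier M"
  shows "h e \<in> CE N \<longleftrightarrow> e \<in> CE M"
proof -
  interpret M: monoid M by fact
  have N: "carrier N = h ` carrier M"
    using assms(2) by (auto simp: iso_def bij_betw_def)
  show ?thesis
    using assms(3)
    by (simp add: CE_def N iso_inj[OF assms(2)] flip: iso_mult[OF assms(2)])
qed

text \<open>The image of a complement \<open>f\<close> of \<open>e\<close> is a complement of
  \<open>h e\<close>. Each candidate bound \<open>u\<close> in \<open>CE N\<close> is pulled back to
  some \<open>v\<close> in \<open>CE M\<close>, where injectivity of \<open>h\<close> turns the
  conditions on \<open>u\<close> into those on \<open>v\<close>.\<close>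

lemma iso_CCE:
  assumes "monoid_with_zero M" "monoid N" "h \<in> iso M N" "e \<in> CCE M"
  shows "h e \<in> CCE N"
proof -
  interpret M: monoid_with_zero M by fact
  note h = assms(3)
  obtain f where f: "f \<in> CE M" "e \<otimes>\<^bsub>M\<^esub> f = monoid_zero M"
      "\<And>u. u \<in> CE M \<Longrightarrow> CE_le M e u \<and> CE_le M f u \<longleftrightarrow> u = \<one>\<^bsub>M\<^esub>"
    using assms(4) by (auto simp: CCE_def)
  have e: "e \<in> CE M" using assms(4) by (simp add: CCE_def)
  note cl = CE_closed[OF e] CE_closed[OF f(1)]
  have "CE_le N (h e) u \<and> CE_le N (h f) u \<longleftrightarrow> u = \<one>\<^bsub>N\<^esub>" if u: "u \<in> CE N" for u
  proof -
    obtain v where v: "v \<in> carrier M" "u = h v"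
      using iso_surj[OF h CE_closed[OF u]] by blast
    have "v \<in> CE M" using u v iso_CE_iff[OF M.monoid_axioms h] by simp
    moreover have "h v = \<one>\<^bsub>N\<^esub> \<longleftrightarrow> v = \<one>\<^bsub>M\<^esub>"
      using iso_inj[OF h v(1) M.one_closed] iso_preserves_one[OF M.monoid_axioms assms(2) h] by simp
    ultimately show ?thesis
      using f(3)[of v] v cl by (simp add: CE_le_def iso_inj[OF h] flip: iso_mult[OF h])
  qed
  moreover have "h e \<otimes>\<^bsub>N\<^esub> h f = monoid_zero N"
    using f(2) cl iso_zero[OF assms(1) h] by (simp flip: iso_mult[OF h])
  ultimately show ?thesis
    using e f(1) cl iso_CE_iff[OF M.monoid_axioms h] unfolding CCE_def by blast
qed

section \<open>Direct products\<close>

lemma monoid_product_group: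
  assumes "\<And>j. j \<in> J \<Longrightarrow> monoid (Q j)"
  shows "monoid (product_group J Q)"
  using assms
  by (intro monoidI) (auto simp: PiE_iff monoid.m_closed monoid.one_closed monoid.m_assoc
      monoid.l_one monoid.r_one extensional_def fun_eq_iff restrict_def)

lemma monoid_zero_product_group:
  assumes "\<And>j. j \<in> J \<Longrightarrow> monoid_with_zero (Q j)"
  shows "monoid_zero (product_group J Q) = (\<lambda>j\<in>J. monoid_zero (Q j))"
  using assms
  by (intro monoid_zero_eqI)
    (auto simp: PiE_iff monoid_with_zero.zero_closed monoid_with_zero.zero_mult intro!: restrict_ext)

lemma monoid_with_zero_product_group:
  assumes "\<And>j. j \<in> J \<Longrightarrow> monoid_with_zero (Q j)"
  shows "monoid_with_zero (product_group J Q)"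
proof (intro monoid_with_zero.intro monoid_with_zero_axioms.intro)
  show "monoid (product_group J Q)"
    using assms by (intro monoid_product_group monoid_with_zero.axioms(1))
  let ?z = "\<lambda>j\<in>J. monoid_zero (Q j)"
  show "\<exists>z\<in>carrier (product_group J Q). \<forall>x\<in>carrier (product_group J Q).
      z \<otimes>\<^bsub>product_group J Q\<^esub> x = z \<and> x \<otimes>\<^bsub>product_group J Q\<^esub> z = z"
    using assms
    by (intro bexI[of _ ?z])
      (auto simp: PiE_iff monoid_with_zero.zero_closed monoid_with_zero.zero_mult intro!: restrict_ext)
qed

section \<open>Central and complemented central idempotents of a direct product\<close>

lemma restrict_upd_in_PiE:
  "j \<in> J \<Longrightarrow> p \<in> A j \<Longrightarrow> (\<And>k. k \<in> J \<Longrightarrow> c k \<in> A k) \<Longrightarrow>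
    (\<lambda>k\<in>J. if k = j then p else c k) \<in> (\<Pi>\<^sub>E k\<in>J. A k)"
  by auto

text \<open>Centrality can be tested one factor at a time, because any \<open>p\<close> in one
  factor extends by units to an element of the product.\<close>

lemma CE_product_group:
  assumes "\<And>j. j \<in> J \<Longrightarrow> monoid (Q j)"
  shows "CE (product_group J Q) = (\<Pi>\<^sub>E j\<in>J. CE (Q j))"
proof (intro equalityI subsetI)
  fix e assume e: "e \<in> CE (product_group J Q)"
  then have E: "e \<in> (\<Pi>\<^sub>E j\<in>J. carrier (Q j))" "(\<lambda>j\<in>J. e j \<otimes>\<^bsub>Q j\<^esub> e j) = e"
    by (auto simp: CE_def)
  have "e j \<in> CE (Q j)" if j: "j \<in> J" for j
  proof -
    have "e j \<otimes>\<^bsub>Q j\<^esub> p = p \<otimes>\<^bsub>Q j\<^esub> e j" if p: "p \<in> carrier (Q j)" for p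
    proof -
      let ?x = "\<lambda>k\<in>J. if k = j then p else \<one>\<^bsub>Q k\<^esub>"
      have "?x \<in> carrier (product_group J Q)"
        using j p assms by (simp add: restrict_upd_in_PiE monoid.one_closed)
      with e have "e \<otimes>\<^bsub>product_group J Q\<^esub> ?x = ?x \<otimes>\<^bsub>product_group J Q\<^esub> e"
        unfolding CE_def by blast
      from fun_cong[OF this, of j] show ?thesis using j by simp
    qed
    moreover have "e j \<otimes>\<^bsub>Q j\<^esub> e j = e j"
      using fun_cong[OF E(2), of j] j by simp
    ultimately show ?thesis using E(1) j by (auto simp: CE_def)
  qed
  with E(1) show "e \<in> (\<Pi>\<^sub>E j\<in>J. CE (Q j))" by (auto simp: PiE_iff)
next
  fix e assume e: "e \<in> (\<Pi>\<^sub>E j\<in>J. CE (Q j))"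
  then have E: "e \<in> extensional J" "\<And>j. j \<in> J \<Longrightarrow> e j \<in> carrier (Q j)"
    and idem: "\<And>j. j \<in> J \<Longrightarrow> e j \<otimes>\<^bsub>Q j\<^esub> e j = e j"
    and comm: "\<And>j p. j \<in> J \<Longrightarrow> p \<in> carrier (Q j) \<Longrightarrow> e j \<otimes>\<^bsub>Q j\<^esub> p = p \<otimes>\<^bsub>Q j\<^esub> e j"
    unfolding CE_def PiE_iff by blast+
  have "e \<in> carrier (product_group J Q)"
    using E by (simp add: PiE_iff)
  moreover have "e \<otimes>\<^bsub>product_group J Q\<^esub> e = e"
    using E(1) by (intro extensionalityI[of _ J]) (simp_all add: idem)
  moreover have "e \<otimes>\<^bsub>product_group J Q\<^esub> x = x \<otimes>\<^bsub>product_group J Q\<^esub> e"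
    if "x \<in> carrier (product_group J Q)" for x
    using that by (simp, intro restrict_ext comm) auto
  ultimately show "e \<in> CE (product_group J Q)"
    unfolding CE_def by blast
qed

text \<open>The product of \<open>e\<close> and \<open>u\<close> is \<open>undefined\<close> off
  \<open>J\<close>; extensionality of \<open>e\<close> therefore lets agreement on \<open>J\<close>
  yield equality of functions.\<close>

lemma CE_le_product_group:
  assumes "e \<in> extensional J"
  shows "CE_le (product_group J Q) e u \<longleftrightarrow> (\<forall>j\<in>J. CE_le (Q j) (e j) (u j))"
  using assms by (auto simp: CE_le_def fun_eq_iff restrict_def extensional_def)

text \<open>Zero, order and \<open>CE\<close> are all coordinatewise. A complement of
  \<open>e\<close> thus restricts to complements in the factors; conversely, complements chosen in
  all factors assemble into one for \<open>e\<close>.\<close>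

lemma CCE_product_group:
  assumes Q: "\<And>j. j \<in> J \<Longrightarrow> monoid_with_zero (Q j)"
  shows "CCE (product_group J Q) = (\<Pi>\<^sub>E j\<in>J. CCE (Q j))"
proof -
  have M: "monoid (Q j)" if "j \<in> J" for j
    using Q[OF that] by (rule monoid_with_zero.axioms(1))
  have CE: "CE (product_group J Q) = (\<Pi>\<^sub>E j\<in>J. CE (Q j))"
    by (rule CE_product_group) (rule M)
  show ?thesis
  proof (intro equalityI subsetI)
    fix e assume "e \<in> CCE (product_group J Q)"
    then obtain f where e: "e \<in> (\<Pi>\<^sub>E j\<in>J. CE (Q j))" and f: "f \<in> (\<Pi>\<^sub>E j\<in>J. CE (Q j))"
      and ef: "(\<lambda>j\<in>J. e j \<otimes>\<^bsub>Q j\<^esub> f j) = (\<lambda>j\<in>J. monoid_zero (Q j))"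
      and u: "\<And>u. u \<in> (\<Pi>\<^sub>E j\<in>J. CE (Q j)) \<Longrightarrow>
        CE_le (product_group J Q) e u \<and> CE_le (product_group J Q) f u \<longleftrightarrow> u = (\<lambda>j\<in>J. \<one>\<^bsub>Q j\<^esub>)"
      by (auto simp: CCE_def CE monoid_zero_product_group[OF Q])
    have "e j \<in> CCE (Q j)" if j: "j \<in> J" for j
    proof -
      have "CE_le (Q j) (e j) p \<and> CE_le (Q j) (f j) p \<longleftrightarrow> p = \<one>\<^bsub>Q j\<^esub>" if p: "p \<in> CE (Q j)" for p
      proof -
        \<comment> \<open>Padding with units makes the bound automatic in every other factor, so
          only the condition on \<open>p\<close> at \<open>j\<close> remains.\<close>
        let ?u = "\<lambda>k\<in>J. if k = j then p else \<one>\<^bsub>Q k\<^esub>"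
        have "?u \<in> (\<Pi>\<^sub>E j\<in>J. CE (Q j))"
          using j p M by (simp add: restrict_upd_in_PiE monoid.one_in_CE)
        moreover have "CE_le (product_group J Q) g ?u \<longleftrightarrow> CE_le (Q j) (g j) p"
          if "g \<in> (\<Pi>\<^sub>E j\<in>J. CE (Q j))" for g
        proof -
          have "CE_le (Q k) (g k) \<one>\<^bsub>Q k\<^esub>" if "k \<in> J" for k
            using PiE_mem[OF \<open>g \<in> _\<close> that] M[OF that] by (simp add: CE_le_def CE_closed monoid.r_one)
          with that j show ?thesis
            by (subst CE_le_product_group) (auto simp: PiE_iff)
        qed
        moreover have "?u = (\<lambda>j\<in>J. \<one>\<^bsub>Q j\<^esub>) \<longleftrightarrow> p = \<one>\<^bsub>Q j\<^esub>"
          using j by (auto simp: fun_eq_iff restrict_def)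
        ultimately show ?thesis using u[of ?u] e f by blast
      qed
      moreover have "e j \<otimes>\<^bsub>Q j\<^esub> f j = monoid_zero (Q j)"
        using fun_cong[OF ef, of j] j by simp
      ultimately show ?thesis
        using e f j unfolding CCE_def by (blast dest: PiE_mem)
    qed
    with e show "e \<in> (\<Pi>\<^sub>E j\<in>J. CCE (Q j))" by (auto simp: PiE_iff)
  next
    fix e assume e: "e \<in> (\<Pi>\<^sub>E j\<in>J. CCE (Q j))"
    then have "\<forall>j\<in>J. \<exists>f. f \<in> CE (Q j) \<and> e j \<otimes>\<^bsub>Q j\<^esub> f = monoid_zero (Q j) \<and>
        (\<forall>u\<in>CE (Q j). CE_le (Q j) (e j) u \<and> CE_le (Q j) f u \<longleftrightarrow> u = \<one>\<^bsub>Q j\<^esub>)"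
      by (fastforce simp: PiE_iff CCE_def)
    then obtain f where f: "\<And>j. j \<in> J \<Longrightarrow> f j \<in> CE (Q j)"
        "\<And>j. j \<in> J \<Longrightarrow> e j \<otimes>\<^bsub>Q j\<^esub> f j = monoid_zero (Q j)"
        "\<And>j u. j \<in> J \<Longrightarrow> u \<in> CE (Q j) \<Longrightarrow>
          CE_le (Q j) (e j) u \<and> CE_le (Q j) (f j) u \<longleftrightarrow> u = \<one>\<^bsub>Q j\<^esub>"
      by metis
    let ?f = "\<lambda>j\<in>J. f j"
    have E: "e \<in> (\<Pi>\<^sub>E j\<in>J. CE (Q j))"
      using e by (auto simp: PiE_iff CCE_def)
    have "\<forall>u\<in>\<Pi>\<^sub>E j\<in>J. CE (Q j).
        CE_le (product_group J Q) e u \<and> CE_le (product_group J Q) ?f u \<longleftrightarrow> u = (\<lambda>j\<in>J. \<one>\<^bsub>Q j\<^esub>)"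
    proof
      fix u assume u: "u \<in> (\<Pi>\<^sub>E j\<in>J. CE (Q j))"
      have "CE_le (product_group J Q) e u \<and> CE_le (product_group J Q) ?f u \<longleftrightarrow> (\<forall>j\<in>J. u j = \<one>\<^bsub>Q j\<^esub>)"
        using E f(3)[OF _ PiE_mem[OF u]] by (auto simp: CE_le_product_group PiE_iff)
      also have "\<dots> \<longleftrightarrow> u = (\<lambda>j\<in>J. \<one>\<^bsub>Q j\<^esub>)"
        using u by (auto simp: PiE_iff fun_eq_iff restrict_def extensional_def)
      finally show "CE_le (product_group J Q) e u \<and> CE_le (product_group J Q) ?f u \<longleftrightarrow>
        u = (\<lambda>j\<in>J. \<one>\<^bsub>Q j\<^esub>)" .
    qed
    moreover have "?f \<in> (\<Pi>\<^sub>E j\<in>J. CE (Q j))" using f(1) by simp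
    moreover have "e \<otimes>\<^bsub>product_group J Q\<^esub> ?f = monoid_zero (product_group J Q)"
      by (simp add: monoid_zero_product_group[OF Q], intro restrict_ext) (simp add: f(2))
    ultimately show "e \<in> CCE (product_group J Q)"
      using E unfolding CCE_def CE one_product_group by (intro CollectI conjI bexI[of _ ?f])
  qed
qed

section \<open>Isomorphisms between products\<close>

text \<open>Padding with zeros rather than units makes the case \<open>p = \<one>\<close> the
  idempotent \<open>\<delta>\<^sub>j\<close>, called the axis unit at \<open>j\<close>
  below.\<close>

definition axis_embed :: "'j set \<Rightarrow> ('j \<Rightarrow> ('q, 'y) monoid_scheme) \<Rightarrow> 'j \<Rightarrow> 'q \<Rightarrow> 'j \<Rightarrow> 'q"
  where "axis_embed J Q j p = (\<lambda>k\<in>J. if k = j then p else monoid_zero (Q k))"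

text \<open>A single flat index set, with possibly isomorphic factors at different indices; nested
  products are brought to this form by a disjoint union of index sets.\<close>

locale CCE_trivial_family =
  fixes J :: "'j set" and Q :: "'j \<Rightarrow> ('q, 'y) monoid_scheme"
  assumes with_zero: "j \<in> J \<Longrightarrow> monoid_with_zero (Q j)"
    and nontrivial: "j \<in> J \<Longrightarrow> \<exists>x\<in>carrier (Q j). \<exists>y\<in>carrier (Q j). x \<noteq> y"
    and CCE_trivial: "j \<in> J \<Longrightarrow> CCE (Q j) = {monoid_zero (Q j), \<one>\<^bsub>Q j\<^esub>}"
begin

abbreviation "R \<equiv> product_group J Q"

lemma monoid_factor: "j \<in> J \<Longrightarrow> monoid (Q j)"
  using with_zero monoid_with_zero.axioms(1) by blast

lemma zero_neq_one: "j \<in> J \<Longrightarrow> monoid_zero (Q j) \<noteq> \<one>\<^bsub>Q j\<^esub>"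
  using with_zero nontrivial monoid_with_zero.zero_neq_one by blast

lemma monoid_R: "monoid R"
  by (intro monoid_product_group monoid_factor)

lemma with_zero_R: "monoid_with_zero R"
  by (intro monoid_with_zero_product_group with_zero)

lemma zero_R: "monoid_zero R = (\<lambda>j\<in>J. monoid_zero (Q j))"
  by (intro monoid_zero_product_group with_zero)

lemma axis_closed: "j \<in> J \<Longrightarrow> p \<in> carrier (Q j) \<Longrightarrow> axis_embed J Q j p \<in> carrier R"
  by (simp add: axis_embed_def restrict_upd_in_PiE monoid_with_zero.zero_closed with_zero)

lemma axis_same [simp]: "j \<in> J \<Longrightarrow> axis_embed J Q j p j = p"
  by (simp add: axis_embed_def)

lemma axis_eq_iff: "j \<in> J \<Longrightarrow> axis_embed J Q j p = axis_embed J Q j q \<longleftrightarrow> p = q"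
  by (metis axis_same)

lemma axis_one_closed: "j \<in> J \<Longrightarrow> axis_embed J Q j \<one>\<^bsub>Q j\<^esub> \<in> carrier R"
  by (simp add: axis_closed monoid_factor monoid.one_closed del: carrier_product_group)

lemma axis_one_eq_iff:
  assumes "j \<in> J" "k \<in> J"
  shows "axis_embed J Q j \<one>\<^bsub>Q j\<^esub> = axis_embed J Q k \<one>\<^bsub>Q k\<^esub> \<longleftrightarrow> j = k"
proof
  assume "axis_embed J Q j \<one>\<^bsub>Q j\<^esub> = axis_embed J Q k \<one>\<^bsub>Q k\<^esub>"
  from fun_cong[OF this, of j] show "j = k"
    using assms zero_neq_one[of j] by (auto simp: axis_embed_def split: if_splits)
qed simp

lemma axis_mult:
  assumes "j \<in> J" "p \<in> carrier (Q j)" "q \<in> carrier (Q j)"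
  shows "axis_embed J Q j (p \<otimes>\<^bsub>Q j\<^esub> q) = axis_embed J Q j p \<otimes>\<^bsub>R\<^esub> axis_embed J Q j q"
  using assms with_zero
  by (auto simp: axis_embed_def monoid_with_zero.zero_mult monoid_with_zero.zero_closed intro!: restrict_ext)

text \<open>At \<open>j\<close> the axis unit is neutral, elsewhere it absorbs. Coordinate
  \<open>j\<close> of \<open>x\<close> is thereby isolated by multiplication alone, so an
  isomorphism can carry it over.\<close>

lemma mult_axis_one:
  assumes "j \<in> J" "x \<in> carrier R"
  shows "x \<otimes>\<^bsub>R\<^esub> axis_embed J Q j \<one>\<^bsub>Q j\<^esub> = axis_embed J Q j (x j)"
  using assms with_zero monoid_factor
  by (auto simp: axis_embed_def PiE_iff monoid_with_zero.zero_mult monoid.r_one intro!: restrict_ext)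

lemma axis_one_in_CCE: "j \<in> J \<Longrightarrow> axis_embed J Q j \<one>\<^bsub>Q j\<^esub> \<in> CCE R"
  by (auto simp: CCE_product_group with_zero CCE_trivial axis_embed_def)

lemma axis_one_neq_zero: "j \<in> J \<Longrightarrow> axis_embed J Q j \<one>\<^bsub>Q j\<^esub> \<noteq> monoid_zero R"
  using zero_neq_one by (metis axis_same restrict_apply' zero_R)

text \<open>Every coordinate of \<open>e\<close> is \<open>0\<close> or \<open>1\<close>, so without
  a unit coordinate \<open>e\<close> would be the zero.\<close>

lemma CCE_R_nonzero:
  assumes "e \<in> CCE R" "e \<noteq> monoid_zero R"
  shows "\<exists>j\<in>J. e j = \<one>\<^bsub>Q j\<^esub>"
proof (rule ccontr)
  assume "\<not> ?thesis"
  then have "e = (\<lambda>j\<in>J. monoid_zero (Q j))"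
    using assms(1) CCE_trivial
    by (fastforce simp: CCE_product_group with_zero PiE_iff extensional_def fun_eq_iff restrict_def)
  then show False using assms(2) zero_R by simp
qed

text \<open>Lying below the axis unit makes all coordinates other than \<open>j\<close> zero, so the
  unit coordinate that a nonzero \<open>e\<close> must have is at \<open>j\<close>.\<close>

lemma axis_one_minimal:
  assumes "j \<in> J" "e \<in> CCE R" "e \<noteq> monoid_zero R" "e \<otimes>\<^bsub>R\<^esub> axis_embed J Q j \<one>\<^bsub>Q j\<^esub> = e"
  shows "e = axis_embed J Q j \<one>\<^bsub>Q j\<^esub>"
proof -
  have e: "e = axis_embed J Q j (e j)"
    using mult_axis_one[OF assms(1) CCE_closed[OF assms(2)]] assms(4) by simp
  obtain k where "k \<in> J" "e k = \<one>\<^bsub>Q k\<^esub>"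
    using CCE_R_nonzero assms by blast
  then have "k = j"
    using fun_cong[OF e, of k] zero_neq_one by (auto simp: axis_embed_def split: if_splits)
  then show ?thesis using e \<open>e k = _\<close> by simp
qed

end

text \<open>Source and target are separate families so that results about \<open>h\<close> apply to
  its inverse with the roles exchanged.\<close>

locale two_CCE_trivial_families =
  A: CCE_trivial_family J Q + B: CCE_trivial_family K S
  for J :: "'j set" and Q :: "'j \<Rightarrow> ('q, 'y) monoid_scheme"
    and K :: "'k set" and S :: "'k \<Rightarrow> ('s, 'z) monoid_scheme"
begin

text \<open>The image of the axis unit at \<open>j\<close> has a unit coordinate \<open>k\<close>,
  so the axis unit at \<open>k\<close> lies below it. Pulled back along \<open>h\<close>, the latter
  is a nonzero complemented idempotent below the axis unit at \<open>j\<close>, hence equal to it by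
  minimality.\<close>

lemma iso_axis_one:
  assumes h: "h \<in> iso A.R B.R" and j: "j \<in> J"
  shows "\<exists>k\<in>K. h (axis_embed J Q j \<one>\<^bsub>Q j\<^esub>) = axis_embed K S k \<one>\<^bsub>S k\<^esub>"
proof -
  let ?d = "axis_embed J Q j \<one>\<^bsub>Q j\<^esub>"
  define g where "g = inv_into (carrier A.R) h"
  note g = iso_inv_into(1)[OF A.monoid_R h, folded g_def]
    and gh = iso_inv_into(2)[OF A.monoid_R h, folded g_def]
    and hg = iso_inv_into(3)[OF A.monoid_R h, folded g_def]
  have d: "?d \<in> carrier A.R" using A.axis_one_closed[OF j] .
  have hd: "h ?d \<in> CCE B.R"
    using iso_CCE[OF A.with_zero_R B.monoid_R h A.axis_one_in_CCE[OF j]] .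
  have "h ?d \<noteq> monoid_zero B.R"
    using iso_zero[OF A.with_zero_R h] iso_inj[OF h d] A.axis_one_neq_zero[OF j]
      monoid_with_zero.zero_closed[OF A.with_zero_R] by metis
  then obtain k where k: "k \<in> K" "h ?d k = \<one>\<^bsub>S k\<^esub>"
    using B.CCE_R_nonzero[OF hd] by blast
  let ?c = "axis_embed K S k \<one>\<^bsub>S k\<^esub>"
  have c: "?c \<in> carrier B.R" "?c \<in> CCE B.R"
    using B.axis_one_closed[OF k(1)] B.axis_one_in_CCE[OF k(1)] by auto
  \<comment> \<open>The order has \<open>?c\<close> on the left, whereas
    \<open>mult_axis_one\<close> computes with it on the right; centrality of \<open>?c\<close>
    bridges the two.\<close>
  have "?c \<otimes>\<^bsub>B.R\<^esub> h ?d = h ?d \<otimes>\<^bsub>B.R\<^esub> ?c"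
    using c CCE_closed[OF hd] unfolding CCE_def CE_def by blast
  also have "\<dots> = ?c"
    using B.mult_axis_one[OF k(1) CCE_closed[OF hd]] k(2) by simp
  finally have "g (?c \<otimes>\<^bsub>B.R\<^esub> h ?d) = g ?c" by simp
  then have "g ?c \<otimes>\<^bsub>A.R\<^esub> ?d = g ?c"
    using iso_mult[OF g c(1) CCE_closed[OF hd]] gh[OF d] by simp
  moreover have "g ?c \<in> CCE A.R"
    using iso_CCE[OF B.with_zero_R A.monoid_R g c(2)] .
  moreover have "g ?c \<noteq> monoid_zero A.R"
    using iso_zero[OF B.with_zero_R g] iso_inj[OF g c(1)] B.axis_one_neq_zero[OF k(1)]
      monoid_with_zero.zero_closed[OF B.with_zero_R] by metis
  ultimately have "g ?c = ?d" using A.axis_one_minimal[OF j] by blast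
  then have "h ?d = ?c" using hg[OF c(1)] by simp
  then show ?thesis using k(1) by blast
qed

text \<open>The inverse isomorphism yields a map \<open>\<rho>\<close> back. Axis units at distinct
  indices differ because \<open>0 \<noteq> 1\<close>, so \<open>\<pi>\<close> and
  \<open>\<rho>\<close> are mutually inverse.\<close>

lemma iso_product_group_index:
  assumes h: "h \<in> iso A.R B.R"
  obtains \<pi> where "bij_betw \<pi> J K"
    and "\<And>j. j \<in> J \<Longrightarrow> h (axis_embed J Q j \<one>\<^bsub>Q j\<^esub>) = axis_embed K S (\<pi> j) \<one>\<^bsub>S (\<pi> j)\<^esub>"
proof -
  interpret inv: two_CCE_trivial_families K S J Q ..
  define g where "g = inv_into (carrier A.R) h"
  note g = iso_inv_into(1)[OF A.monoid_R h, folded g_def]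
    and gh = iso_inv_into(2)[OF A.monoid_R h, folded g_def]
    and hg = iso_inv_into(3)[OF A.monoid_R h, folded g_def]
  obtain \<pi> where \<pi>: "\<And>j. j \<in> J \<Longrightarrow> \<pi> j \<in> K"
    "\<And>j. j \<in> J \<Longrightarrow> h (axis_embed J Q j \<one>\<^bsub>Q j\<^esub>) = axis_embed K S (\<pi> j) \<one>\<^bsub>S (\<pi> j)\<^esub>"
    using iso_axis_one[OF h] by metis
  obtain \<rho> where \<rho>: "\<And>k. k \<in> K \<Longrightarrow> \<rho> k \<in> J"
    "\<And>k. k \<in> K \<Longrightarrow> g (axis_embed K S k \<one>\<^bsub>S k\<^esub>) = axis_embed J Q (\<rho> k) \<one>\<^bsub>Q (\<rho> k)\<^esub>"
    using inv.iso_axis_one[OF g] by metis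
  have "\<rho> (\<pi> j) = j" if "j \<in> J" for j
    using \<pi> \<rho> that gh[OF A.axis_one_closed] A.axis_one_eq_iff by metis
  moreover have "\<pi> (\<rho> k) = k" if "k \<in> K" for k
    using \<pi> \<rho> that hg[OF B.axis_one_closed] B.axis_one_eq_iff by metis
  ultimately have "bij_betw \<pi> J K"
    using \<pi>(1) \<rho>(1) by (intro bij_betw_byWitness[where f' = \<rho>]) auto
  then show thesis using \<pi>(2) that by blast
qed

text \<open>Multiplying \<open>x\<close> by the axis unit at \<open>j\<close> and applying
  \<open>h\<close> multiplies \<open>h x\<close> by the axis unit at \<open>\<pi> j\<close>. The
  entry of \<open>h x\<close> at \<open>\<pi> j\<close> thus depends on \<open>x j\<close> alone,
  and \<open>\<gamma> j\<close> inherits multiplicativity and bijectivity from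
  \<open>h\<close>.\<close>

lemma iso_product_group_decompose:
  assumes h: "h \<in> iso A.R B.R"
  obtains \<pi> \<gamma> where "bij_betw \<pi> J K" "\<And>j. j \<in> J \<Longrightarrow> \<gamma> j \<in> iso (Q j) (S (\<pi> j))"
    and "\<And>j x. j \<in> J \<Longrightarrow> x \<in> carrier A.R \<Longrightarrow> h x (\<pi> j) = \<gamma> j (x j)"
proof -
  obtain \<pi> where \<pi>: "bij_betw \<pi> J K"
    and ax: "\<And>j. j \<in> J \<Longrightarrow> h (axis_embed J Q j \<one>\<^bsub>Q j\<^esub>) = axis_embed K S (\<pi> j) \<one>\<^bsub>S (\<pi> j)\<^esub>"
    using iso_product_group_index[OF h] by blast
  define \<gamma> where "\<gamma> j p = h (axis_embed J Q j p) (\<pi> j)" for j p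
  have \<pi>K: "\<pi> j \<in> K" if "j \<in> J" for j
    using \<pi> that by (auto simp: bij_betw_def)
  have key: "h (axis_embed J Q j (x j)) = axis_embed K S (\<pi> j) (h x (\<pi> j))"
    if "j \<in> J" "x \<in> carrier A.R" for j x
  proof -
    have "h (axis_embed J Q j (x j)) = h (x \<otimes>\<^bsub>A.R\<^esub> axis_embed J Q j \<one>\<^bsub>Q j\<^esub>)"
      using A.mult_axis_one[OF that] by simp
    also have "\<dots> = h x \<otimes>\<^bsub>B.R\<^esub> axis_embed K S (\<pi> j) \<one>\<^bsub>S (\<pi> j)\<^esub>"
      using iso_mult[OF h that(2) A.axis_one_closed[OF that(1)]] ax[OF that(1)] by simp
    also have "\<dots> = axis_embed K S (\<pi> j) (h x (\<pi> j))"
      using B.mult_axis_one[OF \<pi>K[OF that(1)] iso_closed[OF h that(2)]] .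
    finally show ?thesis .
  qed
  have val: "h x (\<pi> j) = \<gamma> j (x j)" if "j \<in> J" "x \<in> carrier A.R" for j x
    unfolding \<gamma>_def using key[OF that] \<pi>K[OF that(1)] by simp
  have \<gamma>_axis: "h (axis_embed J Q j p) = axis_embed K S (\<pi> j) (\<gamma> j p)"
    if "j \<in> J" "p \<in> carrier (Q j)" for j p
    using key[OF that(1) A.axis_closed[OF that]] that(1) by (simp add: \<gamma>_def)
  have "\<gamma> j \<in> iso (Q j) (S (\<pi> j))" if j: "j \<in> J" for j
  proof -
    have cl: "\<gamma> j p \<in> carrier (S (\<pi> j))" if "p \<in> carrier (Q j)" for p
      using iso_closed[OF h A.axis_closed[OF j that]] \<pi>K[OF j] by (auto simp: \<gamma>_def)
    have mult: "\<gamma> j (p \<otimes>\<^bsub>Q j\<^esub> q) = \<gamma> j p \<otimes>\<^bsub>S (\<pi> j)\<^esub> \<gamma> j q"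
      if "p \<in> carrier (Q j)" "q \<in> carrier (Q j)" for p q
      using iso_mult[OF h A.axis_closed[OF j that(1)] A.axis_closed[OF j that(2)]]
        A.axis_mult[OF j that] \<pi>K[OF j] by (simp add: \<gamma>_def)
    have inj: "inj_on (\<gamma> j) (carrier (Q j))"
    proof (rule inj_onI)
      fix p q assume pq: "p \<in> carrier (Q j)" "q \<in> carrier (Q j)" "\<gamma> j p = \<gamma> j q"
      then have "h (axis_embed J Q j p) = h (axis_embed J Q j q)"
        using \<gamma>_axis[OF j] by simp
      then show "p = q"
        using iso_inj[OF h A.axis_closed[OF j pq(1)] A.axis_closed[OF j pq(2)]] A.axis_eq_iff[OF j]
        by simp
    qed
    \<comment> \<open>The support of the preimage \<open>x\<close> need not be known: by
      \<open>val\<close>, its entry at \<open>j\<close> is already mapped to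
      \<open>q\<close>.\<close>
    have "q \<in> \<gamma> j ` carrier (Q j)" if q: "q \<in> carrier (S (\<pi> j))" for q
    proof -
      obtain x where x: "x \<in> carrier A.R" "h x = axis_embed K S (\<pi> j) q"
        using iso_surj[OF h B.axis_closed[OF \<pi>K[OF j] q]] by blast
      then have "\<gamma> j (x j) = q" using val[OF j x(1)] \<pi>K[OF j] by simp
      moreover have "x j \<in> carrier (Q j)" using x(1) j by auto
      ultimately show ?thesis by blast
    qed
    then show ?thesis
      using cl mult inj by (auto simp: iso_def hom_def bij_betw_def)
  qed
  then show thesis using \<pi> val that by blast
qed

end

section \<open>Automorphism groups\<close>

lemma carrier_AutoGroup: "carrier (AutoGroup M) = iso M M \<inter> extensional (carrier M)"
  by (simp add: AutoGroup_eq)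

lemma mult_AutoGroup:
  "f \<in> carrier (AutoGroup M) \<Longrightarrow> g \<in> carrier (AutoGroup M) \<Longrightarrow>
    f \<otimes>\<^bsub>AutoGroup M\<^esub> g = compose (carrier M) f g"
  by (simp add: AutoGroup_def auto_def BijGroup_def)

text \<open>Members of \<open>AutoGroup\<close> are extensional, so composites must be cut down to
  the carrier; closure keeps products where the restriction agrees with \<open>f\<close>.\<close>

lemma restrict_iso:
  assumes "\<And>a b. a \<in> carrier M \<Longrightarrow> b \<in> carrier M \<Longrightarrow> a \<otimes>\<^bsub>M\<^esub> b \<in> carrier M" "f \<in> iso M N"
  shows "restrict f (carrier M) \<in> iso M N"
  using assms by (auto simp: iso_def hom_def cong: bij_betw_cong)

text \<open>Conjugation by \<open>h\<close> is an isomorphism, with conjugation by \<open>g\<close>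
  as its inverse.\<close>

lemma AutoGroup_cong:
  assumes "monoid M" "M \<cong> N"
  shows "AutoGroup M \<cong> AutoGroup N"
proof -
  obtain h where h: "h \<in> iso M N" using assms(2) by (auto simp: is_iso_def)
  interpret M: monoid M by fact
  define g where "g = inv_into (carrier M) h"
  note g = iso_inv_into(1)[OF assms(1) h, folded g_def]
    and gh = iso_inv_into(2)[OF assms(1) h, folded g_def]
    and hg = iso_inv_into(3)[OF assms(1) h, folded g_def]
  \<comment> \<open>Closure of \<open>N\<close> under its product is transported from
    \<open>M\<close>, as \<open>restrict_iso\<close> asks for it.\<close>
  have Nm: "a \<otimes>\<^bsub>N\<^esub> b \<in> carrier N" if "a \<in> carrier N" "b \<in> carrier N" for a b
  proof -
    have "a \<otimes>\<^bsub>N\<^esub> b = h (g a \<otimes>\<^bsub>M\<^esub> g b)"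
      using that by (simp add: iso_mult[OF h] iso_closed[OF g] hg)
    then show ?thesis
      using that by (simp add: iso_closed[OF h] iso_closed[OF g])
  qed
  define F where "F a = (\<lambda>y\<in>carrier N. h (a (g y)))" for a
  define G where "G b = (\<lambda>x\<in>carrier M. g (b (h x)))" for b
  have F: "F a \<in> carrier (AutoGroup N)" if "a \<in> carrier (AutoGroup M)" for a
  proof -
    have "h \<circ> (a \<circ> g) \<in> iso N N"
      using that g h by (auto simp: carrier_AutoGroup intro!: iso_set_trans)
    from restrict_iso[OF Nm this] show ?thesis by (simp add: F_def carrier_AutoGroup comp_def)
  qed
  have G: "G b \<in> carrier (AutoGroup M)" if "b \<in> carrier (AutoGroup N)" for b
  proof -
    have "g \<circ> (b \<circ> h) \<in> iso M M"
      using that g h by (auto simp: carrier_AutoGroup intro!: iso_set_trans)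
    from restrict_iso[OF M.m_closed this] show ?thesis by (simp add: G_def carrier_AutoGroup comp_def)
  qed
  have "F \<in> iso (AutoGroup M) (AutoGroup N)"
  proof (rule isoI)
    show "F \<in> hom (AutoGroup M) (AutoGroup N)"
    proof (rule homI)
      fix a b assume ab: "a \<in> carrier (AutoGroup M)" "b \<in> carrier (AutoGroup M)"
      have "b x \<in> carrier M" if "x \<in> carrier M" for x
        using ab(2) that by (auto simp: carrier_AutoGroup iso_closed)
      with ab F show "F (a \<otimes>\<^bsub>AutoGroup M\<^esub> b) = F a \<otimes>\<^bsub>AutoGroup N\<^esub> F b"
        by (simp add: mult_AutoGroup)
          (auto simp: F_def compose_def gh iso_closed[OF g] iso_closed[OF h] intro!: restrict_ext)
    qed (rule F)
    have "G (F a) = a" if "a \<in> carrier (AutoGroup M)" for a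
    proof (rule extensionalityI[of _ "carrier M"])
      fix x assume "x \<in> carrier M"
      moreover from this have "a x \<in> carrier M"
        using that by (simp add: carrier_AutoGroup iso_closed[of a M M])
      ultimately show "G (F a) x = a x"
        by (simp add: G_def F_def gh iso_closed[OF h])
    qed (use that in \<open>simp_all add: G_def carrier_AutoGroup\<close>)
    moreover have "F (G b) = b" if "b \<in> carrier (AutoGroup N)" for b
    proof (rule extensionalityI[of _ "carrier N"])
      fix x assume "x \<in> carrier N"
      moreover from this have "b x \<in> carrier N"
        using that by (simp add: carrier_AutoGroup iso_closed[of b N N])
      ultimately show "F (G b) x = b x"
        by (simp add: G_def F_def hg iso_closed[OF g])
    qed (use that in \<open>simp_all add: F_def carrier_AutoGroup\<close>)
    ultimately show "bij_betw F (carrier (AutoGroup M)) (carrier (AutoGroup N))"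
      using F G by (intro bij_betw_byWitness[where f' = G]) auto
  qed
  then show ?thesis by (auto simp: is_iso_def)
qed

text \<open>Uncurrying flattens the nested product to one over pairs, the shape that
  \<open>CCE_trivial_family\<close> handles.\<close>

lemma product_group_Sigma:
  "product_group \<Lambda> (\<lambda>l. product_group (I l) (Q l)) \<cong> product_group (Sigma \<Lambda> I) (\<lambda>k. Q (fst k) (snd k))"
    (is "?N \<cong> ?R")
proof -
  define F where "F x = (\<lambda>k\<in>Sigma \<Lambda> I. x (fst k) (snd k))" for x :: "'a \<Rightarrow> 'b \<Rightarrow> 'c"
  define G where "G y = (\<lambda>l\<in>\<Lambda>. \<lambda>i\<in>I l. y (l, i))" for y :: "'a \<times> 'b \<Rightarrow> 'c"
  have F: "F x \<in> carrier ?R" if "x \<in> carrier ?N" for x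
    using that by (auto simp: F_def PiE_iff)
  have G: "G y \<in> carrier ?N" if "y \<in> carrier ?R" for y
    using that by (auto simp: G_def PiE_iff)
  have "G (F x) = x" if "x \<in> carrier ?N" for x
    using that by (auto simp: F_def G_def PiE_iff fun_eq_iff restrict_def extensional_def)
  moreover have "F (G y) = y" if "y \<in> carrier ?R" for y
    using that by (auto simp: F_def G_def PiE_iff fun_eq_iff restrict_def extensional_def)
  ultimately have "bij_betw F (carrier ?N) (carrier ?R)"
    using F G by (intro bij_betw_byWitness[where f' = G]) blast+
  moreover have "F (x \<otimes>\<^bsub>?N\<^esub> y) = F x \<otimes>\<^bsub>?R\<^esub> F y" for x y
    by (auto simp: F_def fun_eq_iff restrict_def)
  ultimately have "F \<in> iso ?N ?R"
    using F by (auto intro!: isoI homI simp del: carrier_product_group)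
  then show ?thesis by (auto simp: is_iso_def)
qed

section \<open>The wreath product action\<close>

text \<open>This is the unrestricted wreath product of the automorphism group of \<open>P\<close>
  with the symmetric group on \<open>I\<close>.\<close>

abbreviation (input) wreath_group ::
    "('p, 'y) monoid_scheme \<Rightarrow> 'i set \<Rightarrow> (('i \<Rightarrow> 'p \<Rightarrow> 'p) \<times> ('i \<Rightarrow> 'i)) monoid"
  where "wreath_group P I \<equiv>
    semidirect_product (product_group I (\<lambda>_. AutoGroup P)) (BijGroup I) (permute_coords I)"

locale wreath_family =
  fixes P :: "'l \<Rightarrow> ('p, 'y) monoid_scheme" and I :: "'l \<Rightarrow> 'i set" and \<Lambda> :: "'l set"
  assumes P_with_zero: "l \<in> \<Lambda> \<Longrightarrow> monoid_with_zero (P l)"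
    and P_nontrivial: "l \<in> \<Lambda> \<Longrightarrow> \<exists>x\<in>carrier (P l). \<exists>y\<in>carrier (P l). x \<noteq> y"
    and P_CCE: "l \<in> \<Lambda> \<Longrightarrow> CCE (P l) = {monoid_zero (P l), \<one>\<^bsub>P l\<^esub>}"
    and P_noniso: "l \<in> \<Lambda> \<Longrightarrow> k \<in> \<Lambda> \<Longrightarrow> l \<noteq> k \<Longrightarrow> \<not> P l \<cong> P k"
begin

sublocale CCE_trivial_family "Sigma \<Lambda> I" "\<lambda>k. P (fst k)"
  by (rule CCE_trivial_family.intro) (auto simp: P_with_zero P_nontrivial P_CCE)

text \<open>Automorphisms are isomorphisms from the family to itself.\<close>

sublocale pair: two_CCE_trivial_families "Sigma \<Lambda> I" "\<lambda>k. P (fst k)" "Sigma \<Lambda> I" "\<lambda>k. P (fst k)" ..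

abbreviation "T \<equiv> product_group \<Lambda> (\<lambda>l. wreath_group (P l) (I l))"

text \<open>Entries are first permuted within each block \<open>l\<close>, then the automorphism at
  the new position is applied. This order matches the semidirect multiplication, and the outer
  restriction provides the extensionality required by \<open>AutoGroup\<close>.\<close>

definition act where
  "act t = (\<lambda>x\<in>carrier R. \<lambda>k\<in>Sigma \<Lambda> I.
    fst (t (fst k)) (snd k) (x (fst k, inv_into (I (fst k)) (snd (t (fst k))) (snd k))))"

lemma carrier_T:
  "t \<in> carrier T \<longleftrightarrow> t \<in> extensional \<Lambda> \<and>
    (\<forall>l\<in>\<Lambda>. fst (t l) \<in> (\<Pi>\<^sub>E i\<in>I l. carrier (AutoGroup (P l))) \<and> snd (t l) \<in> Bij (I l))"
  by (auto simp: PiE_iff semidirect_product_def BijGroup_def mem_Times_iff)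

lemma T_auto:
  assumes "t \<in> carrier T" "l \<in> \<Lambda>" "i \<in> I l"
  shows "fst (t l) i \<in> iso (P l) (P l)" "fst (t l) i \<in> extensional (carrier (P l))"
  using assms unfolding carrier_T by (auto simp: PiE_iff carrier_AutoGroup)

lemma T_perm:
  assumes "t \<in> carrier T" "l \<in> \<Lambda>"
  shows "bij_betw (snd (t l)) (I l) (I l)"
  using assms unfolding carrier_T by (auto simp: Bij_def)

lemma T_perm_closed: "t \<in> carrier T \<Longrightarrow> l \<in> \<Lambda> \<Longrightarrow> i \<in> I l \<Longrightarrow> snd (t l) i \<in> I l"
  using T_perm bij_betwE by blast

lemma T_perm_cover:
  assumes "t \<in> carrier T" "l \<in> \<Lambda>" "i \<in> I l"
  obtains i' where "i' \<in> I l" "i = snd (t l) i'"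
  using T_perm[OF assms(1,2)] assms(3) unfolding bij_betw_def by blast

text \<open>Evaluating at a moved position eliminates \<open>inv_into\<close>. By
  \<open>T_perm_cover\<close> every position has this form, so the coordinate computations below
  rest on this equation.\<close>

lemma act_perm:
  assumes "t \<in> carrier T" "x \<in> carrier R" "l \<in> \<Lambda>" "i \<in> I l"
  shows "act t x (l, snd (t l) i) = fst (t l) (snd (t l) i) (x (l, i))"
  using assms T_perm_closed[OF assms(1,3,4)] bij_betw_inv_into_left[OF T_perm[OF assms(1,3)] assms(4)]
  by (simp add: act_def)

lemma act_closed:
  assumes "t \<in> carrier T" "x \<in> carrier R"
  shows "act t x \<in> carrier R"
proof -
  have "act t x (l, i) \<in> carrier (P l)" if li: "l \<in> \<Lambda>" "i \<in> I l" for l i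
  proof -
    obtain i' where i': "i' \<in> I l" "i = snd (t l) i'"
      using T_perm_cover[OF assms(1) li] .
    moreover have "x (l, i') \<in> carrier (P l)" using assms(2) li i' by (auto simp: PiE_iff)
    ultimately show ?thesis
      using act_perm[OF assms li(1) i'(1)] iso_closed[OF T_auto(1)[OF assms(1) li]] by simp
  qed
  moreover have "act t x \<in> extensional (Sigma \<Lambda> I)"
    using assms(2) by (simp add: act_def)
  ultimately show ?thesis by (auto simp: PiE_iff)
qed

lemma R_eqI:
  assumes "x \<in> carrier R" "y \<in> carrier R" "\<And>l i. l \<in> \<Lambda> \<Longrightarrow> i \<in> I l \<Longrightarrow> x (l, i) = y (l, i)"
  shows "x = y"
  using assms by (intro PiE_ext[of x "Sigma \<Lambda> I"]) auto

lemma act_in_iso: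
  assumes t: "t \<in> carrier T"
  shows "act t \<in> iso R R"
proof (rule isoI)
  have "act t (x \<otimes>\<^bsub>R\<^esub> y) = act t x \<otimes>\<^bsub>R\<^esub> act t y" if xy: "x \<in> carrier R" "y \<in> carrier R" for x y
  proof (rule R_eqI)
    note cl = monoid.m_closed[OF monoid_R]
    show "act t (x \<otimes>\<^bsub>R\<^esub> y) \<in> carrier R" "act t x \<otimes>\<^bsub>R\<^esub> act t y \<in> carrier R"
      by (intro act_closed cl xy t)+
    fix l i assume li: "l \<in> \<Lambda>" "i \<in> I l"
    obtain i' where i': "i' \<in> I l" "i = snd (t l) i'"
      using T_perm_cover[OF t li] .
    have "x (l, i') \<in> carrier (P l)" "y (l, i') \<in> carrier (P l)"
      using xy li i' by (auto simp: PiE_iff)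
    then show "act t (x \<otimes>\<^bsub>R\<^esub> y) (l, i) = (act t x \<otimes>\<^bsub>R\<^esub> act t y) (l, i)"
      using act_perm[OF t cl[OF xy] li(1) i'(1)] act_perm[OF t xy(1) li(1) i'(1)]
        act_perm[OF t xy(2) li(1) i'(1)] iso_mult[OF T_auto(1)[OF t li]] li i'
      by simp
  qed
  then show "act t \<in> hom R R"
    using act_closed[OF t] by (intro homI)
  have "inj_on (act t) (carrier R)"
  proof (rule inj_onI)
    fix x y assume xy: "x \<in> carrier R" "y \<in> carrier R" "act t x = act t y"
    show "x = y"
    proof (rule R_eqI[OF xy(1,2)])
      fix l i assume li: "l \<in> \<Lambda>" "i \<in> I l"
      have "x (l, i) \<in> carrier (P l)" "y (l, i) \<in> carrier (P l)"
        using xy li by (auto simp: PiE_iff)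
      then show "x (l, i) = y (l, i)"
        using act_perm[OF t xy(1) li] act_perm[OF t xy(2) li] xy(3)
          iso_inj[OF T_auto(1)[OF t li(1) T_perm_closed[OF t li]]] by simp
    qed
  qed
  moreover have "y \<in> act t ` carrier R" if y: "y \<in> carrier R" for y
  proof -
    \<comment> \<open>The preimage of \<open>y\<close> is built entry by entry: at \<open>i\<close>
      it must be sent to the entry of \<open>y\<close> at the position to which \<open>i\<close>
      moves.\<close>
    have "\<exists>p\<in>carrier (P l). fst (t l) (snd (t l) i) p = y (l, snd (t l) i)"
      if li: "l \<in> \<Lambda>" "i \<in> I l" for l i
      using iso_surj[OF T_auto(1)[OF t li(1) T_perm_closed[OF t li]]] y li T_perm_closed[OF t li]
      by (auto simp: PiE_iff)
    then obtain c where c: "\<And>l i. l \<in> \<Lambda> \<Longrightarrow> i \<in> I l \<Longrightarrow> c l i \<in> carrier (P l)"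
        "\<And>l i. l \<in> \<Lambda> \<Longrightarrow> i \<in> I l \<Longrightarrow> fst (t l) (snd (t l) i) (c l i) = y (l, snd (t l) i)"
      by metis
    let ?x = "\<lambda>k\<in>Sigma \<Lambda> I. c (fst k) (snd k)"
    have x: "?x \<in> carrier R" using c(1) by auto
    have "act t ?x = y"
    proof (rule R_eqI[OF act_closed[OF t x] y])
      fix l i assume li: "l \<in> \<Lambda>" "i \<in> I l"
      obtain i' where i': "i' \<in> I l" "i = snd (t l) i'"
        using T_perm_cover[OF t li] .
      then show "act t ?x (l, i) = y (l, i)"
        using act_perm[OF t x li(1) i'(1)] c(2)[OF li(1) i'(1)] li by simp
    qed
    then show ?thesis using x by blast
  qed
  ultimately show "bij_betw (act t) (carrier R) (carrier R)"
    using act_closed[OF t] by (auto simp: bij_betw_def simp del: carrier_product_group)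
qed

section \<open>Comparison of the product of wreath products with the automorphism group\<close>

lemma act_in_AutoGroup: "t \<in> carrier T \<Longrightarrow> act t \<in> carrier (AutoGroup R)"
  unfolding carrier_AutoGroup by (simp add: act_in_iso) (simp add: act_def)

lemma group_T: "group T"
  by (intro product_group group_semidirect_permute_coords monoid_with_zero.axioms(1) P_with_zero)

text \<open>At position \<open>snd (t l) i\<close> the twist by \<open>permute_coords\<close>
  cancels and reads \<open>fst (u l)\<close> at \<open>i\<close>.\<close>

lemma T_mult:
  assumes "t \<in> carrier T" "u \<in> carrier T" "l \<in> \<Lambda>" "i \<in> I l"
  shows "snd ((t \<otimes>\<^bsub>T\<^esub> u) l) i = snd (t l) (snd (u l) i)"
    and "fst ((t \<otimes>\<^bsub>T\<^esub> u) l) (snd (t l) i) = compose (carrier (P l)) (fst (t l) (snd (t l) i)) (fst (u l) i)"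
proof -
  have B: "snd (t l) \<in> Bij (I l)" "snd (u l) \<in> Bij (I l)"
    using assms unfolding carrier_T by auto
  show "snd ((t \<otimes>\<^bsub>T\<^esub> u) l) i = snd (t l) (snd (u l) i)"
    using assms B by (simp add: semidirect_product_def case_prod_unfold BijGroup_def compose_def)
  have "fst (t l) (snd (t l) i) \<in> carrier (AutoGroup (P l))" "fst (u l) i \<in> carrier (AutoGroup (P l))"
    using assms T_perm_closed[OF assms(1,3,4)] unfolding carrier_T by (auto simp: PiE_iff)
  then show "fst ((t \<otimes>\<^bsub>T\<^esub> u) l) (snd (t l) i)
      = compose (carrier (P l)) (fst (t l) (snd (t l) i)) (fst (u l) i)"
    using assms(3,4) T_perm_closed[OF assms(1,3,4)]
      bij_betw_inv_into_left[OF T_perm[OF assms(1,3)] assms(4)]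
    by (simp add: semidirect_product_def case_prod_unfold permute_coords_def mult_AutoGroup)
qed

lemma act_mult:
  assumes t: "t \<in> carrier T" and u: "u \<in> carrier T"
  shows "act (t \<otimes>\<^bsub>T\<^esub> u) = compose (carrier R) (act t) (act u)"
proof (rule extensionalityI[of _ "carrier R"])
  have tu: "t \<otimes>\<^bsub>T\<^esub> u \<in> carrier T" using monoid.m_closed[OF group.is_monoid[OF group_T] t u] .
  show "act (t \<otimes>\<^bsub>T\<^esub> u) \<in> extensional (carrier R)" by (simp only: act_def restrict_extensional)
  fix x assume x: "x \<in> carrier R"
  have "act (t \<otimes>\<^bsub>T\<^esub> u) x = act t (act u x)"
  proof (rule R_eqI)
    show "act (t \<otimes>\<^bsub>T\<^esub> u) x \<in> carrier R" "act t (act u x) \<in> carrier R"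
      using act_closed t u tu x by blast+
    fix l i assume li: "l \<in> \<Lambda>" "i \<in> I l"
    \<comment> \<open>Position \<open>i\<close> is traced back through \<open>t\<close> and then
      through \<open>u\<close> to the entry of \<open>x\<close> that arrives there.\<close>
    obtain i1 where i1: "i1 \<in> I l" "i = snd (t l) i1"
      using T_perm_cover[OF t li] .
    obtain i2 where i2: "i2 \<in> I l" "i1 = snd (u l) i2"
      using T_perm_cover[OF u li(1) i1(1)] .
    have "x (l, i2) \<in> carrier (P l)" using x li i2 by (auto simp: PiE_iff)
    then have "act (t \<otimes>\<^bsub>T\<^esub> u) x (l, i) = fst (t l) i (fst (u l) i1 (x (l, i2)))"
      using act_perm[OF tu x li(1) i2(1)] T_mult(1)[OF t u li(1) i2(1)] T_mult(2)[OF t u li(1) i1(1)] i1 i2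
      by (simp add: compose_def)
    also have "\<dots> = act t (act u x) (l, i)"
      using act_perm[OF t act_closed[OF u x] li(1) i1(1)] act_perm[OF u x li(1) i2(1)] i1 i2 by simp
    finally show "act (t \<otimes>\<^bsub>T\<^esub> u) x (l, i) = act t (act u x) (l, i)" .
  qed
  then show "act (t \<otimes>\<^bsub>T\<^esub> u) x = compose (carrier R) (act t) (act u) x"
    using x by (simp only: compose_eq)
qed (simp only: compose_extensional)

text \<open>Elements supported at one position determine \<open>t\<close>: a unit there tracks the
  permutation, since automorphisms fix \<open>0\<close> and \<open>1\<close>, and an arbitrary
  \<open>p\<close> there then reveals the automorphism at the target.\<close>

lemma act_inj: "inj_on act (carrier T)"
proof (rule inj_onI)
  fix t u assume tu: "t \<in> carrier T" "u \<in> carrier T" "act t = act u"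
  have "t l = u l" if l: "l \<in> \<Lambda>" for l
  proof -
    interpret Pl: monoid_with_zero "P l" using P_with_zero[OF l] .
    have perm: "snd (t l) i = snd (u l) i" if i: "i \<in> I l" for i
    proof (rule ccontr)
      let ?x = "axis_embed (Sigma \<Lambda> I) (\<lambda>k. P (fst k)) (l, i) \<one>\<^bsub>P l\<^esub>"
      assume neq: "snd (t l) i \<noteq> snd (u l) i"
      have x: "?x \<in> carrier R" using axis_one_closed[of "(l, i)"] l i by simp
      \<comment> \<open>The same target receives the \<open>1\<close> from \<open>i\<close> under
        \<open>t\<close>, but under \<open>u\<close> the \<open>0\<close> from another position
        \<open>i'\<close>.\<close>
      obtain i' where i': "i' \<in> I l" "snd (t l) i = snd (u l) i'"
        using T_perm_cover[OF tu(2) l T_perm_closed[OF tu(1) l i]] .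
      have a: "fst (t l) (snd (t l) i) \<in> iso (P l) (P l)" "fst (u l) (snd (t l) i) \<in> iso (P l) (P l)"
        using T_auto(1) tu l T_perm_closed[OF tu(1) l i] by blast+
      have "i' \<noteq> i" using neq i' by auto
      then have "?x (l, i') = monoid_zero (P l)" using l i' by (simp add: axis_embed_def)
      then have "act u ?x (l, snd (t l) i) = monoid_zero (P l)"
        using act_perm[OF tu(2) x l i'(1)] i' iso_zero[OF Pl.monoid_with_zero_axioms a(2)] by simp
      moreover have "act t ?x (l, snd (t l) i) = \<one>\<^bsub>P l\<^esub>"
        using act_perm[OF tu(1) x l i] l i iso_preserves_one[OF Pl.monoid_axioms Pl.monoid_axioms a(1)] by simp
      ultimately show False
        using tu(3) Pl.zero_neq_one[OF P_nontrivial[OF l]] by simp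
    qed
    have B: "snd (t l) \<in> Bij (I l)" "snd (u l) \<in> Bij (I l)"
      and E: "fst (t l) \<in> extensional (I l)" "fst (u l) \<in> extensional (I l)"
      using tu l unfolding carrier_T by (auto simp: PiE_iff)
    have s: "snd (t l) = snd (u l)"
      using B perm by (intro extensionalityI[of _ "I l"]) (auto simp: Bij_def)
    have "fst (t l) i = fst (u l) i" if i: "i \<in> I l" for i
    proof (rule extensionalityI[of _ "carrier (P l)"])
      show "fst (t l) i \<in> extensional (carrier (P l))" "fst (u l) i \<in> extensional (carrier (P l))"
        using T_auto(2) tu l i by blast+
      fix p assume p: "p \<in> carrier (P l)"
      obtain i' where i': "i' \<in> I l" "i = snd (t l) i'"
        using T_perm_cover[OF tu(1) l i] .
      let ?x = "axis_embed (Sigma \<Lambda> I) (\<lambda>k. P (fst k)) (l, i') p"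
      have x: "?x \<in> carrier R" using axis_closed[of "(l, i')"] p l i' by simp
      show "fst (t l) i p = fst (u l) i p"
        using act_perm[OF tu(1) x l i'(1)] act_perm[OF tu(2) x l i'(1)] tu(3) i' s l by simp
    qed
    then have "fst (t l) = fst (u l)"
      using E by (intro extensionalityI[of _ "I l"]) auto
    with s show ?thesis by (simp add: prod_eq_iff)
  qed
  then show "t = u"
    using tu by (intro extensionalityI[of _ \<Lambda>]) (simp_all add: carrier_T del: carrier_product_group)
qed

text \<open>The decomposition of \<open>h\<close> gives a permutation \<open>\<pi>\<close> of all
  pairs and isomorphisms of factors along it. Once \<open>\<pi>\<close> is known to preserve blocks,
  it splits into permutations \<open>\<sigma> l\<close>, and the isomorphisms become automorphisms
  of the \<open>P l\<close>.\<close>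

lemma act_surj:
  assumes h: "h \<in> carrier (AutoGroup R)"
  shows "h \<in> act ` carrier T"
proof -
  have h_iso: "h \<in> iso R R" and h_ext: "h \<in> extensional (carrier R)"
    using h unfolding carrier_AutoGroup by blast+
  obtain \<pi> \<gamma> where \<pi>: "bij_betw \<pi> (Sigma \<Lambda> I) (Sigma \<Lambda> I)"
    and \<gamma>: "\<And>k. k \<in> Sigma \<Lambda> I \<Longrightarrow> \<gamma> k \<in> iso (P (fst k)) (P (fst (\<pi> k)))"
    and val: "\<And>k x. k \<in> Sigma \<Lambda> I \<Longrightarrow> x \<in> carrier R \<Longrightarrow> h x (\<pi> k) = \<gamma> k (x k)"
    using pair.iso_product_group_decompose[OF h_iso] by blast
  have \<pi>_closed: "\<pi> k \<in> Sigma \<Lambda> I" if "k \<in> Sigma \<Lambda> I" for k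
    using \<pi> that by (auto simp: bij_betw_def)
  \<comment> \<open>Pairwise nonisomorphism enters here: \<open>\<gamma> k\<close> would identify
    the factors of two different blocks.\<close>
  have \<pi>_fst: "fst (\<pi> k) = fst k" if k: "k \<in> Sigma \<Lambda> I" for k
  proof (rule ccontr)
    assume "fst (\<pi> k) \<noteq> fst k"
    then have "\<not> P (fst k) \<cong> P (fst (\<pi> k))"
      using P_noniso[of "fst k" "fst (\<pi> k)"] k \<pi>_closed[OF k] by (auto simp: mem_Times_iff)
    then show False using is_isoI[OF \<gamma>[OF k]] by blast
  qed
  define \<sigma> where "\<sigma> l = (\<lambda>i\<in>I l. snd (\<pi> (l, i)))" for l
  have \<pi>_eq: "\<pi> (l, i) = (l, \<sigma> l i)" if "l \<in> \<Lambda>" "i \<in> I l" for l i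
    using \<pi>_fst[of "(l, i)"] that by (simp add: \<sigma>_def prod_eq_iff)
  have \<sigma>_bij: "bij_betw (\<sigma> l) (I l) (I l)" if l: "l \<in> \<Lambda>" for l
  proof -
    have "inj_on (\<sigma> l) (I l)"
    proof (rule inj_onI)
      fix i j assume "i \<in> I l" "j \<in> I l" "\<sigma> l i = \<sigma> l j"
      then show "i = j"
        using inj_onD[OF bij_betw_imp_inj_on[OF \<pi>], of "(l, i)" "(l, j)"] \<pi>_eq l by simp
    qed
    moreover have "\<sigma> l i \<in> I l" if "i \<in> I l" for i
      using \<pi>_closed[of "(l, i)"] \<pi>_eq[OF l that] l that by simp
    moreover have "i \<in> \<sigma> l ` I l" if i: "i \<in> I l" for i
    proof -
      have "(l, i) \<in> \<pi> ` Sigma \<Lambda> I" using \<pi> l i by (auto simp: bij_betw_def)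
      then obtain m j where "m \<in> \<Lambda>" "j \<in> I m" "(l, i) = \<pi> (m, j)" by auto
      then show ?thesis using \<pi>_eq by auto
    qed
    ultimately show ?thesis by (auto simp: bij_betw_def)
  qed
  \<comment> \<open>Since \<open>act\<close> applies automorphisms after permuting,
    \<open>\<gamma> (l, i)\<close> has to be stored at the target \<open>\<sigma> l i\<close>, hence
    the inverse.\<close>
  define a where "a l = (\<lambda>i\<in>I l. restrict (\<gamma> (l, inv_into (I l) (\<sigma> l) i)) (carrier (P l)))" for l
  define t where "t = (\<lambda>l\<in>\<Lambda>. (a l, \<sigma> l))"
  have a: "a l (\<sigma> l i) = restrict (\<gamma> (l, i)) (carrier (P l))" if "l \<in> \<Lambda>" "i \<in> I l" for l i
    using that \<sigma>_bij bij_betw_inv_into_left[OF \<sigma>_bij that(2)] by (auto simp: a_def bij_betw_def)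
  have "a l i \<in> carrier (AutoGroup (P l))" if li: "l \<in> \<Lambda>" "i \<in> I l" for l i
  proof -
    obtain i' where i': "i' \<in> I l" "i = \<sigma> l i'"
      using \<sigma>_bij li by (auto simp: bij_betw_def)
    interpret Pl: monoid_with_zero "P l" using P_with_zero[OF li(1)] .
    have "\<gamma> (l, i') \<in> iso (P l) (P l)" using \<gamma>[of "(l, i')"] \<pi>_fst[of "(l, i')"] li i' by simp
    from restrict_iso[OF Pl.m_closed this]
    have "restrict (\<gamma> (l, i')) (carrier (P l)) \<in> iso (P l) (P l)" .
    then show ?thesis using a[OF li(1) i'(1)] i'(2) by (simp add: carrier_AutoGroup)
  qed
  then have t: "t \<in> carrier T"
    unfolding carrier_T using \<sigma>_bij by (auto simp: t_def Bij_def a_def \<sigma>_def simp del: carrier_product_group)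
  have "act t x = h x" if x: "x \<in> carrier R" for x
  proof (rule R_eqI[OF act_closed[OF t x] iso_closed[OF h_iso x]])
    fix l i assume li: "l \<in> \<Lambda>" "i \<in> I l"
    obtain i' where i': "i' \<in> I l" "i = snd (t l) i'"
      using T_perm_cover[OF t li] .
    have "i = \<sigma> l i'" using i' li by (simp add: t_def)
    moreover have "x (l, i') \<in> carrier (P l)" using x li i' by (auto simp: PiE_iff)
    ultimately show "act t x (l, i) = h x (l, i)"
      using act_perm[OF t x li(1) i'(1)] val[OF _ x, of "(l, i')"] \<pi>_eq[OF li(1) i'(1)]
        a[OF li(1) i'(1)] li i' by (simp add: t_def)
  qed
  moreover have "act t \<in> extensional (carrier R)" by (simp only: act_def restrict_extensional)
  ultimately have "act t = h"
    using h_ext by (intro extensionalityI[of _ "carrier R"])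
  then show ?thesis using t by blast
qed

lemma AutoGroup_R_iso: "T \<cong> AutoGroup R"
proof -
  have "act \<in> hom T (AutoGroup R)"
    by (rule homI) (simp_all only: act_in_AutoGroup act_mult mult_AutoGroup)
  moreover have "bij_betw act (carrier T) (carrier (AutoGroup R))"
    unfolding bij_betw_def using act_inj act_in_AutoGroup act_surj by blast
  ultimately show ?thesis using isoI unfolding is_iso_def by blast
qed

end

theorem corollary3p5:
  fixes M :: "('m, 'x) monoid_scheme"
    and P :: "'l \<Rightarrow> ('p, 'y) monoid_scheme"
    and I :: "'l \<Rightarrow> 'i set"
    and \<Lambda> :: "'l set"
  assumes "monoid M"
    and "M \<cong> product_group \<Lambda> (\<lambda>l. product_group (I l) (\<lambda>_. P l))"
    and "\<And>l. l \<in> \<Lambda> \<Longrightarrow> monoid_with_zero (P l)"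
    and "\<And>l. l \<in> \<Lambda> \<Longrightarrow> \<exists>x\<in>carrier (P l). \<exists>y\<in>carrier (P l). x \<noteq> y"
    and "\<And>l. l \<in> \<Lambda> \<Longrightarrow> CCE (P l) = {monoid_zero (P l), \<one>\<^bsub>P l\<^esub>}"
    and "\<And>l k. l \<in> \<Lambda> \<Longrightarrow> k \<in> \<Lambda> \<Longrightarrow> l \<noteq> k \<Longrightarrow> \<not> P l \<cong> P k"
    and "\<And>l. l \<in> \<Lambda> \<Longrightarrow> I l \<noteq> {}"
  shows "AutoGroup M \<cong> product_group \<Lambda> (\<lambda>l.
    semidirect_product (product_group (I l) (\<lambda>_. AutoGroup (P l))) (BijGroup (I l))
      (permute_coords (I l)))"
proof -
  interpret wreath_family P I \<Lambda>
    using assms(3-6) by (rule wreath_family.intro)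
  have "M \<cong> R"
    using iso_trans[OF assms(2) product_group_Sigma] .
  then have "AutoGroup M \<cong> AutoGroup R" by (rule AutoGroup_cong[OF assms(1)])
  moreover have "AutoGroup R \<cong> T" by (rule group.iso_sym[OF group_T AutoGroup_R_iso])
  ultimately show ?thesis by (rule iso_trans)
qed

end
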